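(* Let $\mathcal{H}$ be a right quaternionic Hilbert space and let $T\in\mathcal{B}(\mathcal{H})$ be a normal operator with $T\ne 0$ and $T\neq I$. Then $T$ is an orthogonal projection (i.e. $T^*=T=T^2$) if and only if $$\Lambda_\varepsilon^S(T)=\Omega_{D(0,\sqrt{\varepsilon})}\cup\Omega_{D(1,\sqrt{\varepsilon})}\quad\text{for all }\varepsilon>0,$$ where $D(\lambda,r)=\{z\in\mathbb{C}:|z-\lambda|\le r\}$ is the closed disc in the complex plane.
   Context: $\mathbb{H}$ is the division ring of real quaternions, with $\mathbb{C}=\mathbb{R}+\mathbb{R}i\subset\mathbb{H}$; $\mathrm{Re}(q)$ and $|q|$ denote the real part and modulus of $q\in\mathbb{H}$. $\mathbb{S}=\{m\in\mathbb{H}: m^2=-1\}$ is the sphere of imaginary units. For $X\subseteq\mathbb{C}$ nonempty, its circularization is $\Omega_X=\{\alpha+\beta m:\ \alpha,\beta\in\mathbb{R},\ \alpha+\beta i\in X,\ m\in\mathbb{S}\}$. A right quaternionic Hilbert space is a right $\mathbb{H}$-module with an $\mathbb{H}$-valued inner product (positive definite, right $\mathbb{H}$-linear in the second variable, $\langle x,y\rangle=\overline{\langle y,x\rangle}$), complete in the induced norm. $\mathcal{B}(\mathcal{H})$ is the real Banach algebra of bounded right $\mathbb{H}$-linear operators on $\mathcal{H}$ with the operator norm; $T$ is normal if $TT^*=T^*T$. For $T\in\mathcal{B}(\mathcal{H})$ and $q\in\mathbb{H}$ put $Q_q(T)=T^2-2\,\mathrm{Re}(q)T+|q|^2I$. The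 $S$-spectrum is $\sigma_S(T)=\{q\in\mathbb{H}: Q_q(T)\text{ is not invertible in }\mathcal{B}(\mathcal{H})\}$. For $\varepsilon>0$ the pseudo $S$-spectrum is $\Lambda_\varepsilon^S(T)=\sigma_S(T)\cup\{q\in\mathbb{H}\setminus\sigma_S(T): \|Q_q(T)^{-1}\|\ge 1/\varepsilon\}$. *)

theory Defs
  imports "HOL-Analysis.Analysis"
begin

section \<open>Real quaternions\<close>

codatatype quat = Quat (qRe: real) (qI: real) (qJ: real) (qK: real)

lemma quat_eq_iff: "p = q \<longleftrightarrow> qRe p = qRe q \<and> qI p = qI q \<and> qJ p = qJ q \<and> qK p = qK q"
  by (auto intro: quat.expand)

instantiation quat :: ab_group_add
begin

primcorec zero_quat where
  "qRe 0 = 0" | "qI 0 = 0" | "qJ 0 = 0" | "qK 0 = 0"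

primcorec plus_quat where
  "qRe (p + q) = qRe p + qRe q"
| "qI (p + q) = qI p + qI q"
| "qJ (p + q) = qJ p + qJ q"
| "qK (p + q) = qK p + qK q"

primcorec uminus_quat where
  "qRe (- p) = - qRe p" | "qI (- p) = - qI p" | "qJ (- p) = - qJ p" | "qK (- p) = - qK p"

primcorec minus_quat where
  "qRe (p - q) = qRe p - qRe q"
| "qI (p - q) = qI p - qI q"
| "qJ (p - q) = qJ p - qJ q"
| "qK (p - q) = qK p - qK q"

instance
  by standard (simp_all add: quat_eq_iff)

end

instantiation quat :: ring_1
begin

primcorec one_quat where
  "qRe 1 = 1" | "qI 1 = 0" | "qJ 1 = 0" | "qK 1 = 0"

primcorec times_quat where
  "qRe (p * q) = qRe p * qRe q - qI p * qI q - qJ p * qJ q - qK p * qK q"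
| "qI (p * q) = qRe p * qI q + qI p * qRe q + qJ p * qK q - qK p * qJ q"
| "qJ (p * q) = qRe p * qJ q - qI p * qK q + qJ p * qRe q + qK p * qI q"
| "qK (p * q) = qRe p * qK q + qI p * qJ q - qJ p * qI q + qK p * qRe q"

instance
  by standard (simp_all add: quat_eq_iff algebra_simps)

end

instantiation quat :: real_algebra_1
begin

primcorec scaleR_quat where
  "qRe (scaleR r q) = r * qRe q"
| "qI (scaleR r q) = r * qI q"
| "qJ (scaleR r q) = r * qJ q"
| "qK (scaleR r q) = r * qK q"

instance
  by standard (simp_all add: quat_eq_iff algebra_simps)

end

primcorec qcnj :: "quat \<Rightarrow> quat" where
  "qRe (qcnj q) = qRe q" | "qI (qcnj q) = - qI q" | "qJ (qcnj q) = - qJ q" | "qK (qcnj q) = - qK q"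

instantiation quat :: real_inner
begin

definition inner_quat :: "quat \<Rightarrow> quat \<Rightarrow> real" where
  "inner_quat p q = qRe p * qRe q + qI p * qI q + qJ p * qJ q + qK p * qK q"

definition norm_quat :: "quat \<Rightarrow> real" where
  "norm_quat q = sqrt (inner q q)"

definition sgn_quat :: "quat \<Rightarrow> quat" where
  "sgn_quat q = q /\<^sub>R norm q"

definition dist_quat :: "quat \<Rightarrow> quat \<Rightarrow> real" where
  "dist_quat p q = norm (p - q)"

definition uniformity_quat :: "(quat \<times> quat) filter" where
  "uniformity_quat = (INF e\<in>{0 <..}. principal {(x, y). dist x y < e})"

definition open_quat :: "quat set \<Rightarrow> bool" where
  "open_quat U \<longleftrightarrow> (\<forall>x\<in>U. eventually (\<lambda>(x', y). x' = x \<longrightarrow> y \<in> U) uniformity)"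

instance
proof
  fix p q r :: quat and a :: real
  show "inner p q = inner q p"
    by (simp add: inner_quat_def mult.commute)
  show "inner (p + q) r = inner p r + inner q r"
    by (simp add: inner_quat_def algebra_simps)
  show "inner (a *\<^sub>R p) q = a * inner p q"
    by (simp add: inner_quat_def algebra_simps)
  show "0 \<le> inner p p"
    by (simp add: inner_quat_def)
  show "inner p p = 0 \<longleftrightarrow> p = 0"
    by (simp add: inner_quat_def quat_eq_iff add_nonneg_eq_0_iff)
qed (rule norm_quat_def sgn_quat_def dist_quat_def open_quat_def uniformity_quat_def)+

end

instantiation quat :: division_ring
begin

definition inverse_quat :: "quat \<Rightarrow> quat" where
  "inverse_quat q = qcnj q /\<^sub>R (norm q)\<^sup>2"

definition divide_quat :: "quat \<Rightarrow> quat \<Rightarrow> quat" where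
  "divide_quat p q = p * inverse q"

instance
proof
  fix p q :: quat
  have *: "p * qcnj p = of_real ((norm p)\<^sup>2)" "qcnj p * p = of_real ((norm p)\<^sup>2)"
    by (simp_all add: quat_eq_iff of_real_def power2_norm_eq_inner inner_quat_def)
  show "p \<noteq> 0 \<Longrightarrow> inverse p * p = 1" "p \<noteq> 0 \<Longrightarrow> p * inverse p = 1"
    by (simp_all add: inverse_quat_def * of_real_def)
  show "p div q = p * inverse q"
    by (rule divide_quat_def)
  show "inverse (0::quat) = 0"
    by (simp add: inverse_quat_def)
qed

end

instance quat :: real_normed_div_algebra
proof
  fix p q :: quat
  have "inner (p * q) (p * q) = inner p p * inner q q"
    by (simp add: inner_quat_def algebra_simps)
  then show "norm (p * q) = norm p * norm q"
    by (simp add: norm_quat_def real_sqrt_mult)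
qed

text \<open>
  The complex plane inside the quaternions is represented by the type \<open>complex\<close>:
  \<open>Complex \<alpha> \<beta>\<close> stands for the quaternion with components \<open>\<alpha>, \<beta>, 0, 0\<close>.
\<close>

definition imag_units :: "quat set" where
  "imag_units = {m. m\<^sup>2 = -1}"

definition circularization :: "complex set \<Rightarrow> quat set" where
  "circularization X =
     {of_real \<alpha> + of_real \<beta> * m | \<alpha> \<beta> m. Complex \<alpha> \<beta> \<in> X \<and> m \<in> imag_units}"


section \<open>Right quaternionic Hilbert spaces\<close>

text \<open>
  The parent class \<open>real_inner\<close> supplies the underlying real vector space and the norm
  \<open>norm x = sqrt (inner x x)\<close>.  By \<open>inner_eq_qRe\<close> its real inner product is the real part
  of the quaternionic one, so it is no additional datum, and (since \<open>qinner x x\<close> is real)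
  positive definiteness of \<open>qinner\<close> is positive definiteness of \<open>inner\<close>;
  see \<open>qinner_self\<close> and \<open>qinner_self_eq_0_iff\<close> below.
\<close>

class right_quat_inner = real_inner +
  fixes scaleQ :: "'a \<Rightarrow> quat \<Rightarrow> 'a"  (infixl \<open>\<cdot>\<^sub>Q\<close> 75)
    and qinner :: "'a \<Rightarrow> 'a \<Rightarrow> quat"
  assumes scaleQ_add_left: "(x + y) \<cdot>\<^sub>Q p = x \<cdot>\<^sub>Q p + y \<cdot>\<^sub>Q p"
    and scaleQ_add_right: "x \<cdot>\<^sub>Q (p + q) = x \<cdot>\<^sub>Q p + x \<cdot>\<^sub>Q q"
    and scaleQ_scaleQ: "(x \<cdot>\<^sub>Q p) \<cdot>\<^sub>Q q = x \<cdot>\<^sub>Q (p * q)"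
    and scaleQ_one: "x \<cdot>\<^sub>Q 1 = x"
    and scaleQ_of_real: "x \<cdot>\<^sub>Q of_real r = r *\<^sub>R x"
    and qinner_add_right: "qinner x (y + z) = qinner x y + qinner x z"
    and qinner_scaleQ_right: "qinner x (y \<cdot>\<^sub>Q q) = qinner x y * q"
    and qinner_cnj: "qinner x y = qcnj (qinner y x)"
    and inner_eq_qRe: "inner x y = qRe (qinner x y)"

lemma qinner_self: "qinner x x = of_real ((norm x)\<^sup>2)"
  using qinner_cnj[of x x]
  by (simp add: quat_eq_iff of_real_def power2_norm_eq_inner inner_eq_qRe)

lemma qinner_self_eq_0_iff: "qinner x x = 0 \<longleftrightarrow> x = 0"
  by (simp add: qinner_self)

class right_quat_hilbert = right_quat_inner + complete_space


section \<open>Bounded right-linear operators\<close>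

definition qops :: "('h::right_quat_hilbert \<Rightarrow>\<^sub>L 'h) set" where
  "qops = {T. \<forall>x q. blinfun_apply T (x \<cdot>\<^sub>Q q) = blinfun_apply T x \<cdot>\<^sub>Q q}"

text \<open>
  For \<open>T \<in> qops\<close> the described operator exists and is unique (Riesz representation,
  using completeness), so the description operator is well-defined there.
\<close>

definition qadjoint :: "('h::right_quat_hilbert \<Rightarrow>\<^sub>L 'h) \<Rightarrow> 'h \<Rightarrow>\<^sub>L 'h" where
  "qadjoint T = (THE S. S \<in> qops \<and>
     (\<forall>x y. qinner (blinfun_apply S x) y = qinner x (blinfun_apply T y)))"

definition qnormal :: "('h::right_quat_hilbert \<Rightarrow>\<^sub>L 'h) \<Rightarrow> bool" where
  "qnormal T \<longleftrightarrow> T o\<^sub>L qadjoint T = qadjoint T o\<^sub>L T"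

definition orthogonal_projection :: "('h::right_quat_hilbert \<Rightarrow>\<^sub>L 'h) \<Rightarrow> bool" where
  "orthogonal_projection T \<longleftrightarrow> qadjoint T = T \<and> T = T o\<^sub>L T"

definition is_qinverse ::
  "('h::right_quat_hilbert \<Rightarrow>\<^sub>L 'h) \<Rightarrow> ('h \<Rightarrow>\<^sub>L 'h) \<Rightarrow> bool" where
  "is_qinverse A B \<longleftrightarrow> B \<in> qops \<and> A o\<^sub>L B = id_blinfun \<and> B o\<^sub>L A = id_blinfun"

definition qinvertible :: "('h::right_quat_hilbert \<Rightarrow>\<^sub>L 'h) \<Rightarrow> bool" where
  "qinvertible A \<longleftrightarrow> (\<exists>B. is_qinverse A B)"

definition qinverse :: "('h::right_quat_hilbert \<Rightarrow>\<^sub>L 'h) \<Rightarrow> 'h \<Rightarrow>\<^sub>L 'h" where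
  "qinverse A = (THE B. is_qinverse A B)"


section \<open>The S-spectrum and the pseudo S-spectrum\<close>

definition Q_op :: "quat \<Rightarrow> ('h::right_quat_hilbert \<Rightarrow>\<^sub>L 'h) \<Rightarrow> 'h \<Rightarrow>\<^sub>L 'h" where
  "Q_op q T = (T o\<^sub>L T) - (2 * qRe q) *\<^sub>R T + (norm q)\<^sup>2 *\<^sub>R id_blinfun"

definition S_spectrum :: "('h::right_quat_hilbert \<Rightarrow>\<^sub>L 'h) \<Rightarrow> quat set" where
  "S_spectrum T = {q. \<not> qinvertible (Q_op q T)}"

definition pseudo_S_spectrum :: "real \<Rightarrow> ('h::right_quat_hilbert \<Rightarrow>\<^sub>L 'h) \<Rightarrow> quat set" where
  "pseudo_S_spectrum \<epsilon> T =
     S_spectrum T \<union> {q. q \<notin> S_spectrum T \<and> norm (qinverse (Q_op q T)) \<ge> 1 / \<epsilon>}"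

end

theory Submission
  imports Defs
begin

text \<open>
  For a projection, \<open>Q\<^sub>q(T) = |1 - q|\<^sup>2 T + |q|\<^sup>2 (I - T)\<close>, which gives the norm of its inverse at once.
  Conversely, the pseudo-spectra say that \<open>\<parallel>Q\<^sub>q(T) x\<parallel> \<ge> min (|q|\<^sup>2, |1 - q|\<^sup>2) \<parallel>x\<parallel>\<close>.  Letting \<open>q\<close>
  tend to infinity along \<open>q = - t\<close>, \<open>q = 1 + t\<close> and \<open>Re q = 1/2\<close> yields, for the real inner product,
  \<open>0 \<le> (Tx, x) \<le> (x, x)\<close> and \<open>(Tx, x) \<le> (T\<^sup>2x, x)\<close>.  These three numerical inequalities
  already force \<open>T\<close> to be symmetric and idempotent, so no spectral theorem is needed.
\<close>

section \<open>Quaternions and circularizations\<close>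

lemma qRe_mult_commute: "qRe (p * q) = qRe (q * p)"
  by simp

lemma qcnj_mult: "qcnj (p * q) = qcnj q * qcnj p"
  by (simp add: quat_eq_iff algebra_simps)

lemma qRe_of_real [simp]: "qRe (of_real r) = r"
  and qI_of_real [simp]: "qI (of_real r) = 0"
  and qJ_of_real [simp]: "qJ (of_real r) = 0"
  and qK_of_real [simp]: "qK (of_real r) = 0"
  by (simp_all add: of_real_def)

lemma norm_quat_power2: "(norm q)\<^sup>2 = (qRe q)\<^sup>2 + (qI q)\<^sup>2 + (qJ q)\<^sup>2 + (qK q)\<^sup>2"
  unfolding power2_norm_eq_inner by (simp add: inner_quat_def power2_eq_square)

text \<open>Taking 1, i, j, k for \<open>r\<close> reads off the components of \<open>p\<close> up
  to sign. This lifts identities for the real inner product to \<open>qinner\<close>.\<close>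

lemma quat_eqI_qRe_mult:
  assumes "\<And>r. qRe (p * r) = qRe (q * r)"
  shows "p = q"
  using assms[of "Quat 1 0 0 0"] assms[of "Quat 0 1 0 0"] assms[of "Quat 0 0 1 0"]
    assms[of "Quat 0 0 0 1"]
  by (simp add: quat_eq_iff)

text \<open>The imaginary components of \<open>m * m\<close> are \<open>2 * qRe m\<close> times
  those of \<open>m\<close>, so a nonzero real part would make \<open>m\<close> a real number with
  square -1.\<close>

lemma imag_units_iff:
  "m \<in> imag_units \<longleftrightarrow> qRe m = 0 \<and> (qI m)\<^sup>2 + (qJ m)\<^sup>2 + (qK m)\<^sup>2 = 1"
proof
  assume "m \<in> imag_units"
  then have "m * m = - 1"
    by (simp add: imag_units_def power2_eq_square)
  then have e: "qRe m * qRe m - qI m * qI m - qJ m * qJ m - qK m * qK m = -1"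
    "qRe m * qI m = 0" "qRe m * qJ m = 0" "qRe m * qK m = 0"
    by (auto simp: quat_eq_iff)
  have "qRe m = 0"
  proof (rule ccontr)
    assume "qRe m \<noteq> 0"
    with e have "qRe m * qRe m = -1"
      by simp
    then show False
      using zero_le_square[of "qRe m"] by linarith
  qed
  with e show "qRe m = 0 \<and> (qI m)\<^sup>2 + (qJ m)\<^sup>2 + (qK m)\<^sup>2 = 1"
    by (simp add: power2_eq_square)
next
  assume "qRe m = 0 \<and> (qI m)\<^sup>2 + (qJ m)\<^sup>2 + (qK m)\<^sup>2 = 1"
  then show "m \<in> imag_units"
    by (simp add: imag_units_def power2_eq_square quat_eq_iff)
qed

text \<open>\<beta> is the length of the imaginary part and \<open>m\<close> its direction; if
  \<beta> = 0, any unit serves and i is taken.\<close>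

lemma quat_polar:
  obtains \<beta> m where "m \<in> imag_units" "q = of_real (qRe q) + of_real \<beta> * m"
proof -
  define \<beta> where "\<beta> = sqrt ((qI q)\<^sup>2 + (qJ q)\<^sup>2 + (qK q)\<^sup>2)"
  have \<beta>2: "\<beta>\<^sup>2 = (qI q)\<^sup>2 + (qJ q)\<^sup>2 + (qK q)\<^sup>2"
    by (simp add: \<beta>_def)
  show thesis
  proof (cases "\<beta> = 0")
    case True
    have "qI q = 0 \<and> qJ q = 0 \<and> qK q = 0"
      using \<beta>2 True by (simp add: add_nonneg_eq_0_iff)
    then show thesis
      by (intro that[of "Quat 0 1 0 0" 0]) (simp_all add: imag_units_iff quat_eq_iff)
  next
    case False
    show thesis
    proof (rule that[of "Quat 0 (qI q / \<beta>) (qJ q / \<beta>) (qK q / \<beta>)" \<beta>])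
      show "Quat 0 (qI q / \<beta>) (qJ q / \<beta>) (qK q / \<beta>) \<in> imag_units"
        using False
        by (simp add: imag_units_iff power_divide flip: add_divide_distrib \<beta>2)
      show "q = of_real (qRe q) + of_real \<beta> * Quat 0 (qI q / \<beta>) (qJ q / \<beta>) (qK q / \<beta>)"
        using False by (simp add: quat_eq_iff)
    qed
  qed
qed

lemma norm_quat_polar:
  assumes "m \<in> imag_units"
  shows "norm (of_real \<alpha> + of_real \<beta> * m) = cmod (Complex \<alpha> \<beta>)"
proof -
  have "qRe m = 0"
    using assms by (simp add: imag_units_iff)
  then have "(norm (of_real \<alpha> + of_real \<beta> * m))\<^sup>2
      = \<alpha>\<^sup>2 + \<beta>\<^sup>2 * ((qI m)\<^sup>2 + (qJ m)\<^sup>2 + (qK m)\<^sup>2)"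
    by (simp add: norm_quat_power2 power_mult_distrib distrib_left)
  also have "\<dots> = (cmod (Complex \<alpha> \<beta>))\<^sup>2"
    using assms by (simp add: imag_units_iff cmod_power2)
  finally show ?thesis
    by simp
qed

text \<open>The distance from \<alpha> + \<beta> m to a real number does not depend on the unit
  \<open>m\<close>, so a disc with real centre sweeps out a full ball.\<close>

lemma circularization_cball_of_real:
  "circularization (cball (of_real c) r) = cball (of_real c) r"
proof -
  have *: "dist (of_real c) (of_real \<alpha> + of_real \<beta> * m) = dist (of_real c) (Complex \<alpha> \<beta>)"
    if "m \<in> imag_units" for \<alpha> \<beta> :: real and m
  proof -
    have "dist (of_real c) (of_real \<alpha> + of_real \<beta> * m) = norm (of_real (\<alpha> - c) + of_real \<beta> * m)"
      by (subst dist_commute) (simp add: dist_norm algebra_simps)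
    also have "\<dots> = cmod (Complex (\<alpha> - c) \<beta>)"
      using that by (rule norm_quat_polar)
    also have "\<dots> = dist (of_real c) (Complex \<alpha> \<beta>)"
      by (simp add: dist_commute[of "of_real c"] dist_norm cmod_def power2_commute)
    finally show ?thesis .
  qed
  show ?thesis
  proof (intro equalityI subsetI)
    fix q :: quat
    assume "q \<in> circularization (cball (of_real c) r)"
    then show "q \<in> cball (of_real c) r"
      using * by (auto simp: circularization_def)
  next
    fix q :: quat
    assume "q \<in> cball (of_real c) r"
    moreover obtain \<beta> m where "m \<in> imag_units" "q = of_real (qRe q) + of_real \<beta> * m"
      by (rule quat_polar)
    ultimately show "q \<in> circularization (cball (of_real c) r)"
      using *[of m "qRe q" \<beta>] by (auto simp: circularization_def)
  qed
qed

text \<open>For idempotent \<open>T\<close> this is the factor by which \<open>Q_op q T\<close> acts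
  on the range of \<open>T\<close>.\<close>

lemma norm_one_minus_power2: "(norm (1 - q :: quat))\<^sup>2 = 1 - 2 * qRe q + (norm q)\<^sup>2"
  unfolding norm_quat_power2 by (simp add: power2_eq_square algebra_simps)


section \<open>Adjoints\<close>

text \<open>Variational proof: \<open>J\<close> is bounded below, completeness gives a limit of a
  minimizing sequence, and stationarity at that minimizer \<open>z\<close> is the representation of
  \<open>f\<close>.\<close>

lemma riesz_representation:
  fixes f :: "'a::{real_inner, complete_space} \<Rightarrow> real"
  assumes "bounded_linear f"
  obtains z where "\<And>x. f x = inner z x"
proof -
  interpret f: bounded_linear f by fact
  define J where "J x = (norm x)\<^sup>2 - 2 * f x" for x
  obtain K where K: "\<And>x. norm (f x) \<le> norm x * K"
    using f.bounded by blast
  have "- K\<^sup>2 \<le> J x" for x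
  proof -
    have "0 \<le> (norm x - K)\<^sup>2"
      by simp
    with K[of x] show ?thesis
      by (simp add: J_def power2_eq_square algebra_simps)
  qed
  then have bdd: "bdd_below (range J)"
    by (auto simp: bdd_below_def)
  define d where "d = (INF x. J x)"
  have d_le: "d \<le> J x" for x
    unfolding d_def by (rule cINF_lower[OF bdd]) simp
  have "\<exists>x. J x < d + 1 / (real n + 1)" for n
    using cINF_less_iff[of UNIV J "d + 1 / (real n + 1)"] bdd by (auto simp: d_def)
  then obtain X where X: "\<And>n. J (X n) < d + 1 / (real n + 1)"
    by metis
  \<comment> \<open>The parallelogram law turns near-minimality of \<open>x\<close> and \<open>y\<close> into closeness.\<close>
  have para: "(norm (x - y))\<^sup>2 \<le> 2 * (J x - d) + 2 * (J y - d)" for x y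
  proof -
    have "J x + J y - 2 * J ((1/2) *\<^sub>R (x + y)) = (norm (x - y))\<^sup>2 / 2"
      by (simp add: J_def power2_norm_eq_inner f.add f.scaleR inner_simps inner_commute
          algebra_simps add_divide_distrib diff_divide_distrib)
    moreover have "d \<le> J ((1/2) *\<^sub>R (x + y))"
      by (rule d_le)
    ultimately show ?thesis
      by argo
  qed
  have "Cauchy X"
  proof (rule metric_CauchyI)
    fix e :: real
    assume "e > 0"
    \<comment> \<open>From \<open>N\<close> on, each excess over \<open>d\<close> is below e^2/4, so
      the parallelogram bound is below e^2.\<close>
    then obtain N where N: "4 / e\<^sup>2 < real N"
      using reals_Archimedean2 by blast
    have "dist (X m) (X n) < e" if "N \<le> m" "N \<le> n" for m n
    proof -
      have le: "1 / (real k + 1) < e\<^sup>2 / 4" if "N \<le> k" for k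
      proof -
        have "4 < real N * e\<^sup>2"
          using N \<open>e > 0\<close> by (simp add: field_simps)
        also have "\<dots> \<le> (real k + 1) * e\<^sup>2"
          using that by (intro mult_right_mono) auto
        finally show ?thesis
          by (simp add: field_simps)
      qed
      have "(norm (X m - X n))\<^sup>2 < e\<^sup>2"
        using para[of "X m" "X n"] X[of m] X[of n] le[OF \<open>N \<le> m\<close>] le[OF \<open>N \<le> n\<close>]
        by argo
      then show ?thesis
        using \<open>e > 0\<close> by (simp add: dist_norm power2_less_imp_less)
    qed
    then show "\<exists>N. \<forall>m\<ge>N. \<forall>n\<ge>N. dist (X m) (X n) < e"
      by blast
  qed
  then obtain z where z: "X \<longlonglongrightarrow> z"
    using Cauchy_convergent convergent_def by blast
  have "(\<lambda>n. J (X n)) \<longlonglongrightarrow> J z"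
    unfolding J_def by (intro tendsto_intros f.tendsto z)
  moreover have "(\<lambda>n. d + 1 / (real n + 1)) \<longlonglongrightarrow> d + 0"
    using LIMSEQ_inverse_real_of_nat by (intro tendsto_intros) (simp add: field_simps)
  ultimately have "J z \<le> d + 0"
    by (rule LIMSEQ_le) (use X less_imp_le in blast)
  then have min: "J z \<le> J x" for x
    using d_le[of x] by linarith
  have "f x = inner z x" for x
  proof -
    \<comment> \<open>The step \<open>c / n\<close> is the optimal c/|x|^2 with the denominator
      raised by 1, which avoids dividing by zero at \<open>x = 0\<close> and still lowers
      \<open>J\<close> unless \<open>c = 0\<close>.\<close>
    define c where "c = inner z x - f x"
    define n where "n = (norm x)\<^sup>2 + 1"
    have n: "n > 0"
      by (simp add: n_def add_nonneg_pos)
    have "J (z - s *\<^sub>R x) = J z - 2 * s * c + s\<^sup>2 * (n - 1)" for s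
      unfolding J_def c_def n_def power2_norm_eq_inner
      by (simp add: f.diff f.scaleR inner_simps inner_commute power2_eq_square algebra_simps)
    then have "J (z - (c / n) *\<^sub>R x) = J z - 2 * (c / n) * c + (c / n)\<^sup>2 * (n - 1)" .
    also have "\<dots> = J z - c\<^sup>2 / n - (c / n)\<^sup>2"
      using n by (simp add: field_simps power2_eq_square)
    finally have "c\<^sup>2 / n + (c / n)\<^sup>2 \<le> 0"
      using min[of "z - (c / n) *\<^sub>R x"] by linarith
    moreover have "0 \<le> c\<^sup>2 / n"
      using n by simp
    ultimately have "(c / n)\<^sup>2 \<le> 0"
      by linarith
    with n show ?thesis
      by (simp add: c_def)
  qed
  then show thesis
    by (rule that)
qed

text \<open>\<open>qinner\<close> is conjugate linear on the left, and the real part of a product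
  ignores the order of its factors.\<close>

lemma inner_scaleQ_left: "inner (x \<cdot>\<^sub>Q q) y = inner x (y \<cdot>\<^sub>Q qcnj q)"
proof -
  have "qinner (x \<cdot>\<^sub>Q q) y = qcnj q * qinner x y"
    by (metis qcnj_mult qinner_cnj qinner_scaleQ_right)
  then show ?thesis
    using qRe_mult_commute[of "qcnj q" "qinner x y"]
    by (simp only: inner_eq_qRe qinner_scaleQ_right)
qed

lemma eq_if_inner_eq:
  assumes "\<And>z. inner x z = inner y z"
  shows "x = y"
  using assms[of "x - y"] inner_eq_zero_iff[of "x - y"] by (simp add: inner_diff_left)

text \<open>Replacing \<open>y\<close> by \<open>y \<cdot>\<^sub>Q q\<close> for all
  \<open>q\<close> recovers the whole quaternion from its real part, so adjoints can be handled with
  \<open>inner\<close> alone.\<close>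

lemma qinner_adjoint_iff:
  assumes "T \<in> qops"
  shows "(\<forall>x y. qinner (S x) (y::'h::right_quat_hilbert) = qinner x (blinfun_apply T y)) \<longleftrightarrow>
    (\<forall>x y. inner (S x) y = inner x (blinfun_apply T y))"
proof
  assume "\<forall>x y. inner (S x) y = inner x (blinfun_apply T y)"
  then have *: "inner (S x) (y \<cdot>\<^sub>Q q) = inner x (blinfun_apply T y \<cdot>\<^sub>Q q)" for x y q
    using assms by (simp add: qops_def)
  show "\<forall>x y. qinner (S x) y = qinner x (blinfun_apply T y)"
    using *[unfolded inner_eq_qRe qinner_scaleQ_right] by (blast intro: quat_eqI_qRe_mult)
qed (simp add: inner_eq_qRe)

text \<open>Riesz gives \<open>S\<close> pointwise; linearity over the reals and the quaternions
  follows because a vector is determined by its inner products.\<close>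

lemma ex_adjoint:
  fixes T :: "'h::right_quat_hilbert \<Rightarrow>\<^sub>L 'h"
  assumes "T \<in> qops"
  obtains S where "S \<in> qops" "\<And>x y. inner (blinfun_apply S x) y = inner x (blinfun_apply T y)"
proof -
  have "\<exists>z. \<forall>x. inner y (blinfun_apply T x) = inner z x" for y
  proof -
    have "bounded_linear (\<lambda>x. inner y (blinfun_apply T x))"
      by (rule bounded_linear_compose[OF bounded_linear_inner_right blinfun.bounded_linear_right])
    then show ?thesis
      by (rule riesz_representation) blast
  qed
  then obtain S where S: "\<And>x y. inner (S x) y = inner x (blinfun_apply T y)"
    by metis
  have "bounded_linear S"
  proof (rule bounded_linear_intro)
    show "S (x + y) = S x + S y" for x y
      by (rule eq_if_inner_eq) (simp add: inner_add_left S)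
    show "S (r *\<^sub>R x) = r *\<^sub>R S x" for r x
      by (rule eq_if_inner_eq) (simp add: S)
    show "norm (S x) \<le> norm x * norm T" for x
    proof (cases "S x = 0")
      case False
      have "norm (S x) * norm (S x) = inner x (blinfun_apply T (S x))"
        by (metis S norm_eq_sqrt_inner real_sqrt_mult_self abs_of_nonneg inner_ge_zero)
      also have "\<dots> \<le> norm x * (norm T * norm (S x))"
        by (meson norm_blinfun norm_cauchy_schwarz mult_left_mono norm_ge_zero order_trans)
      finally have "norm (S x) * norm (S x) \<le> (norm x * norm T) * norm (S x)"
        by (simp add: mult.assoc)
      then show ?thesis
        using False by simp
    qed simp
  qed
  then have app: "blinfun_apply (Blinfun S) = S"
    by (rule bounded_linear_Blinfun_apply)
  have "S (x \<cdot>\<^sub>Q q) = S x \<cdot>\<^sub>Q q" for x q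
    by (rule eq_if_inner_eq) (use assms in \<open>simp add: inner_scaleQ_left S qops_def\<close>)
  then have "Blinfun S \<in> qops"
    by (simp add: qops_def app)
  then show thesis
    using that S app by metis
qed

text \<open>Existence and uniqueness remove the description operator, so that self-adjointness
  becomes symmetry for \<open>inner\<close>.\<close>

lemma qadjoint_eq_iff:
  fixes T :: "'h::right_quat_hilbert \<Rightarrow>\<^sub>L 'h"
  assumes T: "T \<in> qops"
  shows "qadjoint T = S \<longleftrightarrow>
    S \<in> qops \<and> (\<forall>x y. inner (blinfun_apply S x) y = inner x (blinfun_apply T y))"
proof -
  let ?P = "\<lambda>S. S \<in> qops \<and> (\<forall>x y. inner (blinfun_apply S x) y = inner x (blinfun_apply T y))"
  have def: "qadjoint T = (THE S. ?P S)"
    by (simp add: qadjoint_def qinner_adjoint_iff[OF T])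
  have unique: "S = S'" if "?P S" "?P S'" for S S'
    by (rule blinfun_eqI, rule eq_if_inner_eq) (use that in simp)
  obtain S0 where S0: "?P S0"
    using ex_adjoint[OF T] by metis
  have "qadjoint T = S0"
    unfolding def by (rule the_equality) (use S0 unique in blast)+
  then show ?thesis
    using S0 unique by metis
qed

lemma orthogonal_projection_iff:
  assumes "T \<in> qops"
  shows "orthogonal_projection T \<longleftrightarrow>
    (\<forall>x y. inner (blinfun_apply T x) y = inner x (blinfun_apply T y)) \<and>
    (\<forall>x. blinfun_apply T (blinfun_apply T x) = blinfun_apply T x)"
proof -
  have "T = T o\<^sub>L T \<longleftrightarrow> (\<forall>x. blinfun_apply T (blinfun_apply T x) = blinfun_apply T x)"
    by (metis blinfun_eqI blinfun_apply_blinfun_compose)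
  then show ?thesis
    by (simp add: orthogonal_projection_def qadjoint_eq_iff[OF assms] assms)
qed


section \<open>Resolvent bounds\<close>

lemma qinverse_eqI:
  assumes "is_qinverse A B"
  shows "qinverse A = B"
  unfolding qinverse_def
proof (rule the_equality)
  show "is_qinverse A B" by fact
  fix C
  assume "is_qinverse A C"
  then have "C o\<^sub>L A = id_blinfun" and "A o\<^sub>L B = id_blinfun"
    using assms by (auto simp: is_qinverse_def)
  then show "C = B"
    by (metis blinfun_apply_blinfun_compose blinfun_apply_id_blinfun blinfun_eqI id_apply)
qed

lemma Q_op_apply:
  "blinfun_apply (Q_op q T) x = blinfun_apply T (blinfun_apply T x)
     - (2 * qRe q) *\<^sub>R blinfun_apply T x + (norm q)\<^sup>2 *\<^sub>R x"
  by (simp add: Q_op_def blinfun.bilinear_simps)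

text \<open>For \<epsilon> < r^2 the point \<open>q\<close> avoids both closed balls, so the inverse
  of \<open>Q_op q T\<close> has norm below 1/\<epsilon>. At \<epsilon> = r^2 it may lie on a
  boundary, hence the limit from the left.\<close>

lemma Q_op_lower_bound:
  assumes eq: "\<forall>\<epsilon>>0. pseudo_S_spectrum \<epsilon> T =
      circularization (cball 0 (sqrt \<epsilon>)) \<union> circularization (cball 1 (sqrt \<epsilon>))"
    and "0 \<le> r" "r \<le> norm q" "r \<le> norm (1 - q)"
  shows "r\<^sup>2 * norm x \<le> norm (blinfun_apply (Q_op q T) x)"
proof (cases "r = 0")
  case False
  with \<open>0 \<le> r\<close> have "r > 0"
    by simp
  have "\<epsilon> * norm x \<le> norm (blinfun_apply (Q_op q T) x)" if \<epsilon>: "0 < \<epsilon>" "\<epsilon> < r\<^sup>2" for \<epsilon>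
  proof -
    have "sqrt \<epsilon> < r"
      using \<epsilon> \<open>r > 0\<close> by (simp add: real_less_lsqrt)
    then have "q \<notin> cball (of_real 0) (sqrt \<epsilon>) \<union> cball (of_real 1) (sqrt \<epsilon>)"
      using assms(3,4) by (auto simp: dist_norm)
    then have "q \<notin> pseudo_S_spectrum \<epsilon> T"
      using eq \<epsilon> circularization_cball_of_real[of 0] circularization_cball_of_real[of 1] by simp
    then have "qinvertible (Q_op q T)" and small: "norm (qinverse (Q_op q T)) < 1 / \<epsilon>"
      by (auto simp: pseudo_S_spectrum_def S_spectrum_def)
    then obtain B where B: "is_qinverse (Q_op q T) B"
      by (auto simp: qinvertible_def)
    then have "norm x = norm (blinfun_apply B (blinfun_apply (Q_op q T) x))"
      by (metis blinfun_apply_blinfun_compose blinfun_apply_id_blinfun id_apply is_qinverse_def)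
    also have "\<dots> \<le> norm B * norm (blinfun_apply (Q_op q T) x)"
      by (rule norm_blinfun)
    also have "\<dots> \<le> 1 / \<epsilon> * norm (blinfun_apply (Q_op q T) x)"
      using small by (intro mult_right_mono) (auto simp: qinverse_eqI[OF B])
    finally show ?thesis
      using \<epsilon> by (simp add: field_simps)
  qed
  then have ev: "\<forall>\<^sub>F \<epsilon> in at_left (r\<^sup>2). \<epsilon> * norm x \<le> norm (blinfun_apply (Q_op q T) x)"
    using \<open>r > 0\<close> by (auto simp: eventually_at_left_field intro!: exI[of _ 0])
  have "((\<lambda>\<epsilon>. \<epsilon> * norm x) \<longlongrightarrow> r\<^sup>2 * norm x) (at_left (r\<^sup>2))"
    by (intro tendsto_intros)
  then show ?thesis
    by (rule tendsto_upperbound[OF _ ev]) simp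
qed simp

section \<open>Numerical inequalities from norm bounds at infinity\<close>

text \<open>Squaring cancels t^2 |x|^2; division by 2t leaves |p t|^2/(2t) + (p t, x) \<ge> 0, whose
  first term vanishes in the limit.\<close>

lemma inner_nonneg_if_norm_add_ge:
  fixes x :: "'a::real_inner"
  assumes p: "(p \<longlongrightarrow> p0) at_top"
    and ge: "\<forall>\<^sub>F t in at_top. t * norm x \<le> norm (p t + t *\<^sub>R x)"
  shows "0 \<le> inner p0 x"
proof -
  have "((\<lambda>t. (norm (p t))\<^sup>2 * inverse t / 2 + inner (p t) x) \<longlongrightarrow>
      (norm p0)\<^sup>2 * 0 / 2 + inner p0 x) at_top"
    by (intro tendsto_intros p tendsto_inverse_0_at_top filterlim_ident) simp
  moreover have "\<forall>\<^sub>F t in at_top. 0 \<le> (norm (p t))\<^sup>2 * inverse t / 2 + inner (p t) x"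
    using ge eventually_gt_at_top[of 0]
  proof eventually_elim
    case (elim t)
    have "(t * norm x)\<^sup>2 \<le> (norm (p t + t *\<^sub>R x))\<^sup>2"
      using elim by (intro power_mono) auto
    also have "\<dots> = (norm (p t))\<^sup>2 + 2 * t * inner (p t) x + (t * norm x)\<^sup>2"
      unfolding power_mult_distrib power2_norm_eq_inner
      by (simp add: inner_simps inner_commute power2_eq_square algebra_simps)
    finally show ?case
      using elim by (simp add: field_simps)
  qed
  ultimately have "0 \<le> (norm p0)\<^sup>2 * 0 / 2 + inner p0 x"
    by (rule tendsto_lowerbound) simp
  then show ?thesis
    by simp
qed

text \<open>Division by t reduces this to the previous lemma with p(t) = u/t + 2v. It serves the
  real rays, where \<open>Q_op q T\<close> is quadratic in t.\<close>

lemma inner_nonneg_if_norm_quadratic_ge: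
  fixes x :: "'a::real_inner"
  assumes ge: "\<And>t. t > 0 \<Longrightarrow> t\<^sup>2 * norm x \<le> norm (u + (2 * t) *\<^sub>R v + t\<^sup>2 *\<^sub>R x)"
  shows "0 \<le> inner v x"
proof -
  have "((\<lambda>t. inverse t *\<^sub>R u + 2 *\<^sub>R v) \<longlongrightarrow> 0 *\<^sub>R u + 2 *\<^sub>R v) at_top"
    by (intro tendsto_intros tendsto_inverse_0_at_top filterlim_ident)
  then have "0 \<le> inner (0 *\<^sub>R u + 2 *\<^sub>R v) x"
  proof (rule inner_nonneg_if_norm_add_ge)
    show "\<forall>\<^sub>F t in at_top. t * norm x \<le> norm (inverse t *\<^sub>R u + 2 *\<^sub>R v + t *\<^sub>R x)"
      using eventually_gt_at_top[of 0]
    proof eventually_elim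
      case (elim t)
      then have "u + (2 * t) *\<^sub>R v + t\<^sup>2 *\<^sub>R x
          = t *\<^sub>R (inverse t *\<^sub>R u + 2 *\<^sub>R v + t *\<^sub>R x)"
        by (simp add: scaleR_add_right power2_eq_square)
      with ge[OF elim] elim show ?case
        by (simp add: power2_eq_square)
    qed
  qed
  then show ?thesis
    by simp
qed

section \<open>Symmetry and idempotence from numerical inequalities\<close>

text \<open>Degenerate Cauchy-Schwarz: the value at x + s y is a nonnegative quadratic in s without
  constant term, so its linear coefficient vanishes.\<close>

lemma semidefinite_null_left:
  fixes a :: "'a::real_vector \<Rightarrow> 'a \<Rightarrow> real"
  assumes sym: "\<And>x y. a x y = a y x"
    and lin: "\<And>x. linear (a x)"
    and nonneg: "\<And>x. 0 \<le> a x x"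
    and null: "a x x = 0"
  shows "a x y = 0"
proof -
  \<comment> \<open>The summand 1 keeps \<open>n\<close> positive even if
    \<open>a y y = 0\<close>.\<close>
  define n where "n = a y y + 1"
  have n: "n > 0"
    using nonneg[of y] by (simp add: n_def)
  define s where "s = - a x y / n"
  have lin': "linear (\<lambda>x. a x y)" for y
    using lin[of y] by (simp add: sym[of _ y])
  have "0 \<le> a (x + s *\<^sub>R y) (x + s *\<^sub>R y)"
    by (rule nonneg)
  also have "\<dots> = 2 * s * a x y + s\<^sup>2 * (n - 1)"
    by (simp add: linear_add[OF lin] linear_add[OF lin'] linear_scale[OF lin]
        linear_scale[OF lin'] null sym[of y x] n_def power2_eq_square algebra_simps)
  also have "\<dots> = - n * s\<^sup>2 - s\<^sup>2"
    using n by (simp add: s_def field_simps power2_eq_square)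
  finally have "n * s\<^sup>2 + s\<^sup>2 \<le> 0"
    by linarith
  moreover have "0 \<le> n * s\<^sup>2"
    using n by simp
  ultimately have "s\<^sup>2 \<le> 0"
    by linarith
  with n show ?thesis
    by (simp add: s_def)
qed

lemma symmetric_idempotent_if_numerical_bounds:
  fixes T :: "'a::real_inner \<Rightarrow> 'a"
  assumes "linear T"
    and ge0: "\<And>x. 0 \<le> inner (T x) x"
    and le1: "\<And>x. inner (T x) x \<le> inner x x"
    and sq: "\<And>x. inner (T x) x \<le> inner (T (T x)) x"
  shows "inner (T x) y = inner x (T y)" and "T (T x) = T x"
proof -
  interpret T: linear T by fact
  \<comment> \<open>\<open>T\<close> is not yet known to be symmetric, so its form is symmetrized to
    make the null vector lemma applicable to \<open>a\<close> and \<open>b\<close>.\<close>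
  define a where "a x y = (inner (T x) y + inner (T y) x) / 2" for x y
  define b where "b x y = inner x y - a x y" for x y
  have sym: "a x y = a y x" "b x y = b y x" for x y
    by (simp_all add: a_def b_def inner_commute)
  have lin: "linear (a x)" "linear (b x)" for x
    by (auto intro!: linearI simp: a_def b_def T.add T.scaleR inner_simps field_simps)
  have diag: "a x x = inner (T x) x" for x
    by (simp add: a_def)
  have pos: "0 \<le> a x x" "0 \<le> b x x" for x
    using ge0[of x] le1[of x] by (simp_all add: diag b_def)
  \<comment> \<open>The hypothesis \<open>sq\<close> makes the sum of these two nonnegative values nonpositive.\<close>
  have null: "a (T x - x) (T x - x) = 0 \<and> b (T x) (T x) = 0" for x
  proof -
    have "inner (T (T x)) x = 2 * a (T x) x - inner (T x) (T x)"
      by (simp add: a_def inner_commute field_simps)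
    moreover have "a (T x - x) (T x - x) = a (T x) (T x) - 2 * a (T x) x + a x x"
      by (simp add: a_def T.diff inner_simps inner_commute field_simps)
    ultimately have "a (T x - x) (T x - x) + b (T x) (T x) \<le> 0"
      using sq[of x] by (simp add: b_def diag)
    then show ?thesis
      using pos(1)[of "T x - x"] pos(2)[of "T x"] by linarith
  qed
  have "a (T x - x) y = 0" "b (T x) y = 0" for x y
    using semidefinite_null_left[of a, OF sym(1) lin(1) pos(1)]
      semidefinite_null_left[of b, OF sym(2) lin(2) pos(2)] null by auto
  moreover have "a (T x - x) y = a (T x) y - a x y" for x y
    by (simp add: a_def T.diff inner_simps field_simps)
  \<comment> \<open>\<open>b (T x) y = 0\<close> says that (Tx, y) equals \<open>a (T x) y\<close>,
    and this equals \<open>a x y\<close>, which is symmetric.\<close>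
  ultimately have Ta: "inner (T x) y = a x y" and TTa: "inner (T x) y = a (T x) y" for x y
    by (simp_all add: b_def)
  show "inner (T x) y = inner x (T y)"
    using Ta[of x y] Ta[of y x] sym(1)[of x y] by (simp add: inner_commute)
  show "T (T x) = T x"
    by (rule eq_if_inner_eq) (metis Ta TTa)
qed

lemma projection_if_pseudo_S_spectrum:
  fixes T :: "'h::right_quat_hilbert \<Rightarrow>\<^sub>L 'h"
  assumes T: "T \<in> qops"
    and eq: "\<forall>\<epsilon>>0. pseudo_S_spectrum \<epsilon> T =
      circularization (cball 0 (sqrt \<epsilon>)) \<union> circularization (cball 1 (sqrt \<epsilon>))"
  shows "orthogonal_projection T"
proof -
  note bound = Q_op_lower_bound[OF eq]
  let ?T = "blinfun_apply T"
  have lin: "linear ?T"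
    by (rule bounded_linear.linear[OF blinfun.bounded_linear_right])
  \<comment> \<open>At q = -t the nearer centre is 0, at distance t, and Q is T^2 + 2t T +
    t^2.\<close>
  have ge0: "0 \<le> inner (?T x) x" for x
  proof (rule inner_nonneg_if_norm_quadratic_ge)
    fix t :: real
    assume "t > 0"
    moreover have "norm (1 - of_real (- t) :: quat) = \<bar>1 + t\<bar>"
      using norm_of_real[of "1 + t", where 'a = quat] by simp
    ultimately show "t\<^sup>2 * norm x \<le> norm (?T (?T x) + (2 * t) *\<^sub>R ?T x + t\<^sup>2 *\<^sub>R x)"
      using bound[of t "of_real (- t)" x] by (simp add: Q_op_apply)
  qed
  \<comment> \<open>At q = 1 + t the nearer centre is 1, at distance t, and Q is (I - T)^2 + 2t (I -
    T) + t^2.\<close>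
  have "0 \<le> inner (x - ?T x) x" for x
  proof (rule inner_nonneg_if_norm_quadratic_ge)
    fix t :: real
    assume "t > 0"
    moreover have "norm (of_real (1 + t) :: quat) = \<bar>1 + t\<bar>"
      by (rule norm_of_real)
    moreover have "blinfun_apply (Q_op (of_real (1 + t)) T) x
        = (?T (?T x) - 2 *\<^sub>R ?T x + x) + (2 * t) *\<^sub>R (x - ?T x) + t\<^sup>2 *\<^sub>R x"
      unfolding Q_op_apply norm_of_real
      by (simp add: power2_eq_square algebra_simps flip: scaleR_2)
    moreover have "norm (1 - of_real (1 + t) :: quat) = \<bar>t\<bar>"
      by simp
    ultimately show "t\<^sup>2 * norm x
        \<le> norm ((?T (?T x) - 2 *\<^sub>R ?T x + x) + (2 * t) *\<^sub>R (x - ?T x) + t\<^sup>2 *\<^sub>R x)"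
      using bound[of t "of_real (1 + t)" x] by simp
  qed
  then have le1: "inner (?T x) x \<le> inner x x" for x
    by (simp add: inner_diff_left)
  have "0 \<le> inner (?T (?T x) - ?T x) x" for x
  proof (rule inner_nonneg_if_norm_add_ge[OF tendsto_const])
    have "t * norm x \<le> norm (?T (?T x) - ?T x + t *\<^sub>R x)" if "t > 1/4" for t
    proof -
      \<comment> \<open>This point is at distance sqrt t from both 0 and 1, and its Q is T^2 - T +
        t; the root requires t \<ge> 1/4.\<close>
      define q where "q = Quat (1/2) (sqrt (t - 1/4)) 0 0"
      have "(norm q)\<^sup>2 = t" "(norm (1 - q))\<^sup>2 = t"
        unfolding norm_quat_power2 using that by (simp_all add: q_def power2_eq_square)
      then have "norm q = sqrt t" "norm (1 - q) = sqrt t"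
        by (metis norm_ge_zero real_sqrt_unique)+
      then show ?thesis
        using bound[of "sqrt t" q x] that \<open>(norm q)\<^sup>2 = t\<close> by (simp add: Q_op_apply q_def)
    qed
    then show "\<forall>\<^sub>F t in at_top. t * norm x \<le> norm (?T (?T x) - ?T x + t *\<^sub>R x)"
      by (meson eventually_gt_at_top eventually_mono)
  qed
  then have "inner (?T x) x \<le> inner (?T (?T x)) x" for x
    by (simp add: inner_diff_left)
  note symmetric_idempotent_if_numerical_bounds[OF lin ge0 le1 this]
  then show ?thesis
    unfolding orthogonal_projection_iff[OF T] by blast
qed

section \<open>The pseudo S-spectrum of a projection\<close>

text \<open>The range and kernel of \<open>T\<close> are orthogonal, so Pythagoras gives the upper
  bound. Both are nonzero, and eigenvectors in them for \<open>a\<close> and \<open>b\<close> give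
  the lower bound.\<close>

lemma norm_projection_combination:
  fixes T :: "'h::right_quat_hilbert \<Rightarrow>\<^sub>L 'h"
  assumes sym: "\<And>x y. inner (blinfun_apply T x) y = inner x (blinfun_apply T y)"
    and idem: "\<And>x. blinfun_apply T (blinfun_apply T x) = blinfun_apply T x"
    and "T \<noteq> 0" "T \<noteq> id_blinfun" "0 \<le> a" "0 \<le> b"
  shows "norm (a *\<^sub>R T + b *\<^sub>R (id_blinfun - T)) = max a b"
proof (rule antisym)
  let ?C = "a *\<^sub>R T + b *\<^sub>R (id_blinfun - T)" and ?T = "blinfun_apply T"
  have C: "blinfun_apply ?C x = a *\<^sub>R ?T x + b *\<^sub>R (x - ?T x)" for x
    by (simp add: blinfun.bilinear_simps)
  show "norm ?C \<le> max a b"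
  proof (rule norm_blinfun_bound)
    fix x
    have orth: "inner (?T x) (x - ?T x) = 0"
      by (subst sym) (simp add: blinfun.diff_right idem)
    have "(norm (blinfun_apply ?C x))\<^sup>2 = a\<^sup>2 * (norm (?T x))\<^sup>2 + b\<^sup>2 * (norm (x - ?T x))\<^sup>2"
      unfolding C by (subst norm_add_Pythagorean) (simp_all add: orthogonal_def orth power_mult_distrib)
    also have "\<dots> \<le> (max a b)\<^sup>2 * (norm (?T x))\<^sup>2 + (max a b)\<^sup>2 * (norm (x - ?T x))\<^sup>2"
      using assms(5,6) by (intro add_mono mult_right_mono power_mono) auto
    also have "\<dots> = (max a b)\<^sup>2 * (norm (?T x + (x - ?T x)))\<^sup>2"
      by (subst norm_add_Pythagorean) (simp_all add: orthogonal_def orth distrib_left)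
    finally have "(norm (blinfun_apply ?C x))\<^sup>2 \<le> (max a b * norm x)\<^sup>2"
      by (simp add: power_mult_distrib)
    then show "norm (blinfun_apply ?C x) \<le> max a b * norm x"
      by (rule power2_le_imp_le) (simp add: assms(5) le_max_iff_disj)
  qed (simp add: assms(5) le_max_iff_disj)
  obtain x where "?T x \<noteq> 0"
    using \<open>T \<noteq> 0\<close> by (metis blinfun_eqI zero_blinfun.rep_eq)
  moreover have "a * norm (?T x) \<le> norm ?C * norm (?T x)"
    using norm_blinfun[of ?C "?T x"] assms(5) by (simp add: C idem)
  ultimately have "a \<le> norm ?C"
    by simp
  obtain y where "y - ?T y \<noteq> 0"
    using \<open>T \<noteq> id_blinfun\<close> by (metis blinfun_eqI blinfun_apply_id_blinfun id_apply eq_iff_diff_eq_0)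
  moreover have "b * norm (y - ?T y) \<le> norm ?C * norm (y - ?T y)"
    using norm_blinfun[of ?C "y - ?T y"] assms(6) by (simp add: C idem blinfun.diff_right)
  ultimately have "b \<le> norm ?C"
    by simp
  with \<open>a \<le> norm ?C\<close> show "max a b \<le> norm ?C"
    by simp
qed

lemma pseudo_S_spectrum_projection:
  fixes T :: "'h::right_quat_hilbert \<Rightarrow>\<^sub>L 'h"
  assumes T: "T \<in> qops" and proj: "orthogonal_projection T"
    and "T \<noteq> 0" "T \<noteq> id_blinfun" "\<epsilon> > 0"
  shows "pseudo_S_spectrum \<epsilon> T =
    circularization (cball 0 (sqrt \<epsilon>)) \<union> circularization (cball 1 (sqrt \<epsilon>))"
proof -
  have sym: "inner (blinfun_apply T x) y = inner x (blinfun_apply T y)"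
    and idem: "blinfun_apply T (blinfun_apply T x) = blinfun_apply T x" for x y
    using proj by (simp_all add: orthogonal_projection_iff[OF T])
  \<comment> \<open>These combinations multiply componentwise, so inverting \<open>Q_op q T\<close>
    amounts to taking two reciprocals.\<close>
  define C where "C a b = a *\<^sub>R T + b *\<^sub>R (id_blinfun - T)" for a b
  have C_apply: "blinfun_apply (C a b) x
      = a *\<^sub>R blinfun_apply T x + b *\<^sub>R (x - blinfun_apply T x)" for a b x
    by (simp add: C_def blinfun.bilinear_simps)
  have Q: "Q_op q T = C ((norm (1 - q))\<^sup>2) ((norm q)\<^sup>2)" for q
    by (rule blinfun_eqI)
      (simp add: Q_op_apply C_apply idem norm_one_minus_power2 algebra_simps)
  have C_mult: "C a b o\<^sub>L C c d = C (a * c) (b * d)" for a b c d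
    by (rule blinfun_eqI) (simp add: C_apply idem blinfun.bilinear_simps algebra_simps)
  have C_1: "C 1 1 = id_blinfun"
    by (simp add: C_def)
  \<comment> \<open>Real scalars are central, so real combinations of right-linear operators are
    right linear, as \<open>is_qinverse\<close> demands of the inverse.\<close>
  have C_qops: "C a b \<in> qops" for a b
  proof -
    have "(r *\<^sub>R x) \<cdot>\<^sub>Q q = r *\<^sub>R (x \<cdot>\<^sub>Q q)" for r and x :: 'h and q
    proof -
      have "(r *\<^sub>R x) \<cdot>\<^sub>Q q = x \<cdot>\<^sub>Q (of_real r * q)"
        by (simp only: scaleQ_of_real[symmetric] scaleQ_scaleQ)
      also have "\<dots> = x \<cdot>\<^sub>Q (q * of_real r)"
        by (simp add: of_real_def)
      finally show ?thesis
        by (simp only: scaleQ_of_real[symmetric] scaleQ_scaleQ)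
    qed
    moreover have "(x - y) \<cdot>\<^sub>Q q = x \<cdot>\<^sub>Q q - y \<cdot>\<^sub>Q q" for x y :: 'h and q
      by (metis add_diff_cancel_right' diff_add_cancel scaleQ_add_left)
    ultimately show ?thesis
      using T by (simp add: qops_def C_apply scaleQ_add_left)
  qed
  have spec: "q \<in> S_spectrum T" if "q = 0 \<or> q = 1" for q
  proof (rule ccontr)
    assume "q \<notin> S_spectrum T"
    then obtain B where B: "B o\<^sub>L Q_op q T = id_blinfun"
      by (auto simp: S_spectrum_def qinvertible_def is_qinverse_def)
    \<comment> \<open>\<open>P\<close> is I - T at q = 0 and T at q = 1: a nonzero operator
      annihilated by \<open>Q_op q T\<close>.\<close>
    define P where "P = (if q = 0 then C 0 1 else C 1 0)"
    have "Q_op q T o\<^sub>L P = 0"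
      using that by (auto simp: Q P_def C_mult) (simp_all add: C_def)
    then have "blinfun_apply (Q_op q T) (blinfun_apply P x) = 0" for x
      by (simp flip: blinfun_apply_blinfun_compose)
    then have "blinfun_apply (B o\<^sub>L Q_op q T) (blinfun_apply P x) = 0" for x
      by simp
    then have "P = 0"
      unfolding B by (intro blinfun_eqI) simp
    then show False
      using that assms(3,4) by (auto simp: P_def C_def split: if_splits)
  qed
  have res: "q \<notin> S_spectrum T \<and>
      norm (qinverse (Q_op q T)) = max (1 / (norm (1 - q))\<^sup>2) (1 / (norm q)\<^sup>2)"
    if "q \<noteq> 0" "q \<noteq> 1" for q
  proof -
    have inv: "is_qinverse (Q_op q T) (C (1 / (norm (1 - q))\<^sup>2) (1 / (norm q)\<^sup>2))"
      using that by (simp add: is_qinverse_def Q C_mult C_qops C_1)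
    have "norm (C (1 / (norm (1 - q))\<^sup>2) (1 / (norm q)\<^sup>2))
        = max (1 / (norm (1 - q))\<^sup>2) (1 / (norm q)\<^sup>2)"
      unfolding C_def by (rule norm_projection_combination[OF sym idem assms(3,4)]) auto
    with inv show ?thesis
      by (auto simp: S_spectrum_def qinvertible_def qinverse_eqI[OF inv])
  qed
  have "q \<in> pseudo_S_spectrum \<epsilon> T \<longleftrightarrow> norm q \<le> sqrt \<epsilon> \<or> norm (1 - q) \<le> sqrt \<epsilon>" for q
  \<comment> \<open>At 0 and 1 one coefficient of Q vanishes and the resolvent formula fails; these
    points are spectral and lie in the balls.\<close>
  proof (cases "q = 0 \<or> q = 1")
    case True
    then show ?thesis
      using spec[of q] \<open>\<epsilon> > 0\<close> by (auto simp: pseudo_S_spectrum_def)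
  next
    case False
    have le: "1 / \<epsilon> \<le> 1 / (norm p)\<^sup>2 \<longleftrightarrow> norm p \<le> sqrt \<epsilon>" if "p \<noteq> 0" for p :: quat
    proof -
      have "1 / \<epsilon> \<le> 1 / (norm p)\<^sup>2 \<longleftrightarrow> (norm p)\<^sup>2 \<le> \<epsilon>"
        using that \<open>\<epsilon> > 0\<close> by (simp add: field_simps)
      also have "\<dots> \<longleftrightarrow> norm p \<le> sqrt \<epsilon>"
        using real_sqrt_le_iff[of "(norm p)\<^sup>2" \<epsilon>] by simp
      finally show ?thesis .
    qed
    show ?thesis
      using False res[of q] le[of q] le[of "1 - q"]
      by (auto simp: pseudo_S_spectrum_def le_max_iff_disj)
  qed
  then have "pseudo_S_spectrum \<epsilon> T = cball (of_real 0) (sqrt \<epsilon>) \<union> cball (of_real 1) (sqrt \<epsilon>)"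
    by (simp add: set_eq_iff dist_norm)
  then show ?thesis
    using circularization_cball_of_real[of 0] circularization_cball_of_real[of 1] by simp
qed

theorem theorem4p11:
  fixes T :: "'h::right_quat_hilbert \<Rightarrow>\<^sub>L 'h"
  assumes "T \<in> qops" and "qnormal T" and "T \<noteq> 0" and "T \<noteq> id_blinfun"
  shows "orthogonal_projection T \<longleftrightarrow>
    (\<forall>\<epsilon>>0. pseudo_S_spectrum \<epsilon> T =
       circularization (cball 0 (sqrt \<epsilon>)) \<union> circularization (cball 1 (sqrt \<epsilon>)))"
  using pseudo_S_spectrum_projection projection_if_pseudo_S_spectrum assms by blast

end
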